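(* Let $k\ge 3$ be an integer. There are positive constants $c=c(k)$ and $C=C(k)$ such that for every sufficiently large $n$ there is a $k$-graph $\mathcal{G}$ of order at most $n$ with maximum degree $k+1$ such that $\hat{R}(\mathcal{G})\ge C\, n(\log n)^c$; that is, $\hat{R}(\mathcal{G})=\Omega(n(\log n)^c)$.
   Context: A $k$-graph is a vertex set with a family of $k$-element subsets (edges); the degree of a vertex is the number of edges containing it. For $k$-graphs, $\mathcal{H}\to\mathcal{G}$ means every 2-coloring of the edges of $\mathcal{H}$ yields a monochromatic copy of $\mathcal{G}$, and the size-Ramsey number is $\hat{R}(\mathcal{G})=\min\{|E(\mathcal{H})|:\mathcal{H}\to\mathcal{G}\}$. *)

theory Defs
  imports Complex_Main
begin

text \<open>A hypergraph is a pair of a vertex set and a set of edges.\<close>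

type_synonym 'a hypergraph = "'a set \<times> 'a set set"

abbreviation verts :: "'a hypergraph \<Rightarrow> 'a set" where
  "verts G \<equiv> fst G"

abbreviation edges :: "'a hypergraph \<Rightarrow> 'a set set" where
  "edges G \<equiv> snd G"

definition kgraph :: "nat \<Rightarrow> 'a hypergraph \<Rightarrow> bool" where
  "kgraph k G \<longleftrightarrow> finite (verts G) \<and> (\<forall>e\<in>edges G. e \<subseteq> verts G \<and> card e = k)"

definition degree :: "'a hypergraph \<Rightarrow> 'a \<Rightarrow> nat" where
  "degree G v = card {e \<in> edges G. v \<in> e}"

text \<open>The inserted 0 only matters for the hypergraph without vertices.\<close>

definition max_degree :: "'a hypergraph \<Rightarrow> nat" where
  "max_degree G = Max (insert 0 (degree G ` verts G))"

text \<open>Copies are subgraphs, not necessarily induced.\<close>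

definition contains_copy :: "'a hypergraph \<Rightarrow> 'b hypergraph \<Rightarrow> bool" where
  "contains_copy H G \<longleftrightarrow>
     (\<exists>f. inj_on f (verts G) \<and> f ` verts G \<subseteq> verts H \<and> (\<forall>e\<in>edges G. f ` e \<in> edges H))"

definition arrows :: "'a hypergraph \<Rightarrow> 'b hypergraph \<Rightarrow> bool" where
  "arrows H G \<longleftrightarrow>
     (\<forall>\<chi> :: 'a set \<Rightarrow> bool. \<exists>b. contains_copy (verts H, {e \<in> edges H. \<chi> e = b}) G)"

text \<open>
  Every finite hypergraph is isomorphic to one on natural numbers, so it suffices that the host
  hypergraphs range over those. By Ramsey's theorem the minimum is over a nonempty set whenever
  the argument is a \<open>k\<close>-graph.
\<close>

definition size_ramsey :: "nat \<Rightarrow> 'a hypergraph \<Rightarrow> nat" where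
  "size_ramsey k G =
     (LEAST m. \<exists>H :: nat hypergraph. kgraph k H \<and> arrows H G \<and> card (edges H) = m)"

end

theory Submission
  imports Defs "HOL-Library.Ramsey" "HOL-Library.FuncSet" "HOL-Combinatorics.Permutations"
    "HOL-Real_Asymp.Real_Asymp"
begin

text \<open>
  For a permutation \<open>\<sigma>\<close> of \<open>p\<close> points take the path on \<open>0, \<dots>, 2 p - 1\<close> together with the
  matching joining \<open>i\<close> to \<open>p + \<sigma> i\<close>. The hypergraph \<open>G\<close> consists of one such component for every
  \<open>\<sigma>\<close> and of \<open>M\<close> stars with \<open>k + 1\<close> edges, each edge being enlarged by \<open>k - 2\<close> private vertices.

  Given a host \<open>H\<close>, let \<open>S\<close> be the set of vertices of degree more than \<open>d\<close>. In \<open>H - S\<close> a copy of the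
  component of \<open>\<sigma>\<close> is described by its first vertex and \<open>3 p\<close> choices among at most \<open>d k\<close>
  possibilities, and this description determines \<open>\<sigma>\<close>. As there are \<open>p!\<close> permutations, some \<open>\<sigma>\<close> has only
  a small set \<open>R\<close> of vertices starting a copy. Colour the edges of \<open>H\<close> according to whether they meet
  \<open>S \<union> R\<close>. Those avoiding it contain no copy of the component of \<open>\<sigma>\<close>; those meeting it
  contain no \<open>G\<close> if \<open>card (S \<union> R) < M\<close>, because \<open>G\<close> contains \<open>M\<close> disjoint edges. With
  \<open>p\<close> about \<open>(ln n) powr (1/2)\<close>, \<open>d\<close> about \<open>(ln n) powr (1/16)\<close> and \<open>M\<close> linear in \<open>n\<close>
  this forces \<open>H\<close> to have at least \<open>n (ln n) powr (1/16)\<close> edges.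
\<close>

section \<open>Attainment of the size-Ramsey minimum\<close>

lemma kgraph_finite_edges: "kgraph k H \<Longrightarrow> finite (edges H)"
  unfolding kgraph_def by (rule finite_subset[of _ "Pow (verts H)"]) auto

text \<open>Ramsey's theorem for two colours: in a large complete \<open>k\<close>-graph some colour
  class contains a complete \<open>k\<close>-graph on \<open>card (verts G)\<close> vertices, and
  any bijection onto its vertices embeds \<open>G\<close>. This keeps the \<open>LEAST\<close> in
  \<open>size_ramsey\<close> from ranging over an empty set.\<close>

lemma exists_arrows:
  assumes "kgraph k G"
  shows "\<exists>H :: nat hypergraph. kgraph k H \<and> arrows H G"
proof -
  let ?q = "card (verts G)"
  obtain N :: nat where N: "partn_lst {..<N} [?q, ?q] k"
    using ramsey_full by blast
  let ?H = "({..<N}, nsets {..<N} k)"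
  have fin: "finite (verts G)" and sub: "\<And>e. e \<in> edges G \<Longrightarrow> e \<subseteq> verts G \<and> card e = k"
    using assms by (auto simp: kgraph_def)
  have "arrows ?H G"
    unfolding arrows_def
  proof
    fix \<chi> :: "nat set \<Rightarrow> bool"
    \<comment> \<open>\<open>partn_lst\<close> numbers its colours by list positions, so the Boolean
      colours become 0 and 1.\<close>
    let ?f = "\<lambda>e. if \<chi> e then 0 else 1 :: nat"
    have "?f \<in> nsets {..<N} k \<rightarrow> {..<length [?q, ?q]}" by auto
    with N have "\<exists>i < length [?q, ?q]. monochromatic {..<N} ([?q, ?q] ! i) k ?f i"
      unfolding partn_lst_def by blast
    then obtain i where i: "i < 2" "monochromatic {..<N} ([?q, ?q] ! i) k ?f i"
      unfolding list.size numeral_2_eq_2 by auto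
    have "[?q, ?q] ! i = ?q" using i(1) by (auto simp: less_2_cases_iff)
    with i(2) obtain U where U: "U \<in> nsets {..<N} ?q" and mono: "?f ` nsets U k \<subseteq> {i}"
      unfolding monochromatic_def by auto
    from U have "finite U" "card U = ?q" by (auto simp: nsets_def)
    then obtain f where f: "bij_betw f (verts G) U"
      using finite_same_card_bij[OF fin] by metis
    have "f ` e \<in> nsets U k" if "e \<in> edges G" for e
    proof -
      have "inj_on f e" using f sub[OF that] by (meson bij_betw_def inj_on_subset)
      then show ?thesis
        using f sub[OF that] fin
        by (auto simp: nsets_def card_image bij_betw_def intro: finite_subset)
    qed
    moreover have "\<chi> e = (i = 0)" if "e \<in> nsets U k" for e
      using mono that by (auto split: if_splits)
    moreover have "nsets U k \<subseteq> nsets {..<N} k"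
      using U by (intro nsets_mono) (auto simp: nsets_def)
    ultimately have "f ` e \<in> nsets {..<N} k \<and> \<chi> (f ` e) = (i = 0)" if "e \<in> edges G" for e
      using that by blast
    moreover have "inj_on f (verts G)" "f ` verts G \<subseteq> {..<N}"
      using f U by (auto simp: bij_betw_def nsets_def)
    ultimately have "contains_copy (verts ?H, {e \<in> edges ?H. \<chi> e = (i = 0)}) G"
      unfolding contains_copy_def fst_conv snd_conv by blast
    then show "\<exists>b. contains_copy (verts ?H, {e \<in> edges ?H. \<chi> e = b}) G" by blast
  qed
  moreover have "kgraph k ?H" by (auto simp: kgraph_def nsets_def)
  ultimately show ?thesis by blast
qed

lemma size_ramsey_attained:
  assumes "kgraph k G"
  obtains H :: "nat hypergraph"
  where "kgraph k H" "arrows H G" "card (edges H) = size_ramsey k G"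
proof -
  let ?P = "\<lambda>m. \<exists>H :: nat hypergraph. kgraph k H \<and> arrows H G \<and> card (edges H) = m"
  obtain H :: "nat hypergraph" where "kgraph k H" "arrows H G"
    using exists_arrows[OF assms] by blast
  then have "?P (card (edges H))" by blast
  then have "?P (size_ramsey k G)"
    unfolding size_ramsey_def by (rule LeastI)
  with that show ?thesis by blast
qed

section \<open>Relabelling of vertices\<close>

text \<open>The construction below lives on a sum type; an injective renaming moves it to the
  natural numbers.\<close>

definition rename :: "('a \<Rightarrow> 'b) \<Rightarrow> 'a hypergraph \<Rightarrow> 'b hypergraph" where
  "rename g G = (g ` verts G, (`) g ` edges G)"

lemma inj_on_image_edges:
  assumes "kgraph k G" "inj_on g (verts G)"
  shows "inj_on ((`) g) (edges G)"
  by (rule inj_on_subset[OF inj_on_image_Pow[OF assms(2)]])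
     (use assms(1) in \<open>auto simp: kgraph_def\<close>)

lemma kgraph_rename:
  assumes "kgraph k G" "inj_on g (verts G)"
  shows "kgraph k (rename g G)"
  using assms unfolding kgraph_def rename_def
  by (auto simp: card_image inj_on_subset)

lemma degree_rename:
  assumes "kgraph k G" "inj_on g (verts G)" "v \<in> verts G"
  shows "degree (rename g G) (g v) = degree G v"
proof -
  have "{e \<in> edges (rename g G). g v \<in> e} = (`) g ` {e \<in> edges G. v \<in> e}"
  proof -
    have "g v \<in> g ` e \<longleftrightarrow> v \<in> e" if "e \<in> edges G" for e
      using assms that by (intro inj_on_image_mem_iff[of g "verts G"]) (auto simp: kgraph_def)
    then show ?thesis unfolding rename_def snd_conv by blast
  qed
  moreover have "inj_on ((`) g) {e \<in> edges G. v \<in> e}"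
    using inj_on_image_edges[OF assms(1,2)] by (rule inj_on_subset) auto
  ultimately show ?thesis
    by (simp add: degree_def card_image)
qed

lemma max_degree_rename:
  assumes "kgraph k G" "inj_on g (verts G)"
  shows "max_degree (rename g G) = max_degree G"
proof -
  have "degree (rename g G) ` verts (rename g G) = degree G ` verts G"
    using degree_rename[OF assms] by (force simp: rename_def image_image)
  then show ?thesis by (simp add: max_degree_def)
qed

lemma contains_copy_rename:
  assumes "kgraph k G" "inj_on g (verts G)" "contains_copy H (rename g G)"
  shows "contains_copy H G"
proof -
  obtain f where "inj_on f (g ` verts G)" "f ` g ` verts G \<subseteq> verts H"
    "\<forall>e\<in>edges G. f ` g ` e \<in> edges H"
    using assms(3) by (auto simp: contains_copy_def rename_def)
  then show ?thesis
    using assms(2) unfolding contains_copy_def image_comp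
    by (intro exI[of _ "f \<circ> g"]) (simp add: comp_inj_on image_comp)
qed

lemma arrows_rename:
  assumes "kgraph k G" "inj_on g (verts G)" "arrows H (rename g G)"
  shows "arrows H G"
  using assms(3) contains_copy_rename[OF assms(1,2)] unfolding arrows_def by blast

section \<open>Expansion of graphs to uniform hypergraphs\<close>

text \<open>A private vertex carries its edge as a tag, so private vertices of distinct edges differ
  without any choice of fresh names.\<close>

definition expand_edge :: "nat \<Rightarrow> 'v set \<Rightarrow> ('v + 'v set \<times> nat) set" where
  "expand_edge r e = Inl ` e \<union> Inr ` ({e} \<times> {..<r})"

definition expansion :: "nat \<Rightarrow> 'v set \<Rightarrow> 'v set set \<Rightarrow> ('v + 'v set \<times> nat) hypergraph" where
  "expansion r V D = (Inl ` V \<union> Inr ` (D \<times> {..<r}), expand_edge r ` D)"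

lemma Inl_mem_expand_edge [simp]: "Inl a \<in> expand_edge r e \<longleftrightarrow> a \<in> e"
  and Inr_mem_expand_edge [simp]: "Inr (b, l) \<in> expand_edge r e \<longleftrightarrow> b = e \<and> l < r"
  by (auto simp: expand_edge_def)

lemma inj_expand_edge: "inj (expand_edge r)"
proof (rule injI)
  fix e e' :: "'a set" assume "expand_edge r e = expand_edge r e'"
  then have "a \<in> e \<longleftrightarrow> a \<in> e'" for a by (metis Inl_mem_expand_edge)
  then show "e = e'" by blast
qed

lemma card_expand_edge:
  assumes "finite e"
  shows "card (expand_edge r e) = card e + r"
  unfolding expand_edge_def using assms
  by (subst card_Un_disjoint) (auto simp: card_image)

lemma kgraph_expansion:
  assumes "finite V" "\<And>e. e \<in> D \<Longrightarrow> e \<subseteq> V \<and> card e = 2"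
  shows "kgraph (r + 2) (expansion r V D)"
proof -
  have "finite D" using assms by (intro finite_subset[of D "Pow V"]) auto
  moreover have "card (expand_edge r e) = r + 2" if "e \<in> D" for e
    using assms that by (subst card_expand_edge) (auto intro: finite_subset)
  ultimately show ?thesis
    using assms by (force simp: kgraph_def expansion_def expand_edge_def)
qed

lemma card_verts_expansion:
  assumes "finite V" "finite D"
  shows "card (verts (expansion r V D)) = card V + card D * r"
  unfolding expansion_def using assms
  by (simp, subst card_Un_disjoint) (auto simp: card_image)

lemma degree_expansion_Inl: "degree (expansion r V D) (Inl v) = card {e \<in> D. v \<in> e}"
proof -
  have "{e \<in> edges (expansion r V D). Inl v \<in> e} = expand_edge r ` {e \<in> D. v \<in> e}"
    by (auto simp: expansion_def)
  then show ?thesis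
    by (simp add: degree_def card_image inj_on_subset[OF inj_expand_edge])
qed

lemma degree_expansion_Inr: "degree (expansion r V D) (Inr bl) \<le> 1"
proof -
  obtain b l where bl: "bl = (b, l)" by fastforce
  have "{e \<in> edges (expansion r V D). Inr bl \<in> e} \<subseteq> {expand_edge r b}"
    by (auto simp: expansion_def bl)
  then have "card {e \<in> edges (expansion r V D). Inr bl \<in> e} \<le> card {expand_edge r b}"
    by (intro card_mono) auto
  then show ?thesis by (simp add: degree_def)
qed

section \<open>Braids and the counting of their traces\<close>

text \<open>A matching edge may coincide with a path edge, namely \<open>{p - 1, p}\<close> if
  \<open>\<sigma> (p - 1) = 0\<close>. This is harmless: only upper bounds on the number of edges
  and on degrees are drawn from the braid, and the decoding reads the matching edge of each
  \<open>i\<close> separately.\<close>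

definition braid :: "nat \<Rightarrow> (nat \<Rightarrow> nat) \<Rightarrow> nat set set" where
  "braid p \<sigma> = (\<lambda>j. {j, Suc j}) ` {j. Suc j < 2 * p} \<union> (\<lambda>i. {i, p + \<sigma> i}) ` {..<p}"

text \<open>
  Only the intersection of the host edges with the image of the \<open>2 p\<close> branch vertices is recorded,
  so the private vertices play no role in the counting.
\<close>

definition traced :: "'a set set \<Rightarrow> nat \<Rightarrow> (nat \<Rightarrow> nat) \<Rightarrow> 'a \<Rightarrow> bool" where
  "traced E p \<sigma> v \<longleftrightarrow> (\<exists>g. g 0 = v \<and> inj_on g {..<2 * p} \<and>
     (\<forall>D \<in> braid p \<sigma>. \<exists>e \<in> E. e \<inter> g ` {..<2 * p} = g ` D))"

text \<open>An object may have many codes; choosing one for each is injective because a code can be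
  decoded in only one way.\<close>

lemma card_le_by_codes:
  assumes "finite C" "\<And>x. x \<in> A \<Longrightarrow> \<exists>c\<in>C. Q x c"
    and "\<And>x y c. Q x c \<Longrightarrow> Q y c \<Longrightarrow> x = y"
  shows "card A \<le> card C"
proof -
  obtain h where h: "\<And>x. x \<in> A \<Longrightarrow> h x \<in> C \<and> Q x (h x)"
    using assms(2) by metis
  then have "inj_on h A" by (metis assms(3) inj_onI)
  with h assms(1) show ?thesis by (intro card_inj_on_le[of h]) auto
qed

text \<open>\<open>h\<close> may repeat values or leave \<open>A\<close>, so sets of different sizes
  share one index range.\<close>

lemma surj_enumeration:
  assumes "finite A" "card A \<le> n"
  shows "\<exists>h. A \<subseteq> h ` {..<n :: nat}"
proof -
  obtain h where "bij_betw h {0..<card A} A"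
    using ex_bij_betw_nat_finite[OF assms(1)] by blast
  with assms(2) have "A \<subseteq> h ` {..<n}" by (force simp: bij_betw_def)
  then show ?thesis by blast
qed

text \<open>From the fixed start \<open>v\<close>, a trace is coded by the choice of each next path
  vertex among the vertices of the edges at the current one, and by the choice of an edge at each of
  the first \<open>p\<close> branch vertices for the matching. Each choice has at most
  \<open>d * k\<close> options, and there are fewer than \<open>3 * p\<close> path and matching
  choices in total.\<close>

lemma card_traced_perms:
  fixes E :: "'a set set"
  assumes "finite E" "d > 0" "k > 0"
    and card_E: "\<And>e. e \<in> E \<Longrightarrow> finite e \<and> card e = k"
    and deg: "\<And>v. card {e \<in> E. v \<in> e} \<le> d"
  shows "card {\<sigma>. \<sigma> permutes {..<p} \<and> traced E p \<sigma> v} \<le> (d * k) ^ (3 * p)"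
proof -
  have "\<exists>h. \<Union>{e \<in> E. u \<in> e} \<subseteq> h ` {..<d * k}" for u
  proof (rule surj_enumeration)
    show "finite (\<Union>{e \<in> E. u \<in> e})" using assms by auto
    have "card (\<Union>{e \<in> E. u \<in> e}) \<le> (\<Sum>e\<in>{e \<in> E. u \<in> e}. card e)"
      by (rule card_Union_le_sum_card)
    also have "\<dots> = card {e \<in> E. u \<in> e} * k" using card_E by simp
    also have "\<dots> \<le> d * k" using deg by (rule mult_le_mono1)
    finally show "card (\<Union>{e \<in> E. u \<in> e}) \<le> d * k" .
  qed
  then obtain nb where nb: "\<And>u. \<Union>{e \<in> E. u \<in> e} \<subseteq> nb u ` {..<d * k}" by metis
  \<comment> \<open>The bound \<open>d\<close> on the number of edges is weakened to
    \<open>d * k\<close>, so that both kinds of choices use the same alphabet.\<close>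
  have "\<exists>h. {e \<in> E. u \<in> e} \<subseteq> h ` {..<d * k}" for u
  proof (rule surj_enumeration)
    have "d \<le> d * k" using \<open>k > 0\<close> by simp
    with deg show "card {e \<in> E. u \<in> e} \<le> d * k" using le_trans by blast
  qed (use assms in auto)
  then obtain ed where ed: "\<And>u. {e \<in> E. u \<in> e} \<subseteq> ed u ` {..<d * k}" by metis
  \<comment> \<open>Entries below \<open>2 * p - 1\<close> steer the path; entry
    \<open>2 * p + i\<close> selects the matching edge at branch vertex \<open>i\<close>.\<close>
  define Q where "Q \<sigma> c \<longleftrightarrow> \<sigma> permutes {..<p} \<and> (\<exists>g. g 0 = v \<and> inj_on g {..<2 * p} \<and>
      (\<forall>j. Suc j < 2 * p \<longrightarrow> g (Suc j) = nb (g j) (c j)) \<and>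
      (\<forall>i<p. ed (g i) (c (2 * p + i)) \<inter> g ` {..<2 * p} = g ` {i, p + \<sigma> i}))" for \<sigma> c
  let ?C = "PiE {..<3 * p} (\<lambda>_. {..<d * k})"
  have "card {\<sigma>. \<sigma> permutes {..<p} \<and> traced E p \<sigma> v} \<le> card ?C"
  proof (rule card_le_by_codes[where Q = Q])
    show "finite ?C" by (rule finite_PiE) auto
  next
    fix \<sigma> assume "\<sigma> \<in> {\<sigma>. \<sigma> permutes {..<p} \<and> traced E p \<sigma> v}"
    then have "traced E p \<sigma> v" and perm: "\<sigma> permutes {..<p}" by simp_all
    then obtain g where g: "g 0 = v \<and> inj_on g {..<2 * p} \<and>
        (\<forall>D \<in> braid p \<sigma>. \<exists>e \<in> E. e \<inter> g ` {..<2 * p} = g ` D)"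
      unfolding traced_def by (elim exE)
    note g0 = g[THEN conjunct1]
      and inj = g[THEN conjunct2, THEN conjunct1]
      and tr = g[THEN conjunct2, THEN conjunct2, THEN bspec]
    have "\<exists>i<d * k. (Suc x < 2 * p \<longrightarrow> g (Suc x) = nb (g x) i) \<and>
        (2 * p \<le> x \<longrightarrow> ed (g (x - 2 * p)) i \<inter> g ` {..<2 * p} = g ` {x - 2 * p, p + \<sigma> (x - 2 * p)})"
      if x: "x < 3 * p" for x
    proof -
      consider "Suc x < 2 * p" | "Suc x = 2 * p" | "2 * p \<le> x" by linarith
      then show ?thesis
      proof cases
        case 1
        then have "{x, Suc x} \<in> braid p \<sigma>" by (auto simp: braid_def)
        from tr[OF this] obtain e where "e \<in> E" "g x \<in> e" "g (Suc x) \<in> e" by blast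
        then have "g (Suc x) \<in> nb (g x) ` {..<d * k}" using nb[of "g x"] by blast
        with 1 show ?thesis by auto
      next
        \<comment> \<open>The index \<open>2 * p - 1\<close> encodes no choice; 0 is a legal filler
          because \<open>d * k\<close> is positive.\<close>
        case 2
        then show ?thesis using assms by (intro exI[of _ 0]) auto
      next
        case 3
        let ?i = "x - 2 * p"
        have "?i < p" using x 3 by auto
        then have "{?i, p + \<sigma> ?i} \<in> braid p \<sigma>" by (auto simp: braid_def)
        from tr[OF this] obtain e where e: "e \<in> E" "e \<inter> g ` {..<2 * p} = g ` {?i, p + \<sigma> ?i}"
          by blast
        then have "e \<in> {e \<in> E. g ?i \<in> e}" by blast
        then have "e \<in> ed (g ?i) ` {..<d * k}" using ed[of "g ?i"] by blast
        with e(2) 3 show ?thesis by auto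
      qed
    qed
    then obtain c where c: "\<And>x. x < 3 * p \<Longrightarrow> c x < d * k \<and> (Suc x < 2 * p \<longrightarrow> g (Suc x) = nb (g x) (c x)) \<and>
        (2 * p \<le> x \<longrightarrow> ed (g (x - 2 * p)) (c x) \<inter> g ` {..<2 * p} = g ` {x - 2 * p, p + \<sigma> (x - 2 * p)})"
      by metis
    have "g (Suc j) = nb (g j) (c j)" if "Suc j < 2 * p" for j
      using c[of j] that by simp
    moreover have "ed (g i) (c (2 * p + i)) \<inter> g ` {..<2 * p} = g ` {i, p + \<sigma> i}" if "i < p" for i
      using c[of "2 * p + i"] that by simp
    ultimately have "Q \<sigma> (restrict c {..<3 * p})"
      unfolding Q_def using perm g0 inj by (intro conjI exI[of _ g]) auto
    moreover have "restrict c {..<3 * p} \<in> ?C" using c by auto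
    ultimately show "\<exists>c\<in>?C. Q \<sigma> c" by blast
  next
    fix \<sigma> \<tau> c assume "Q \<sigma> c" "Q \<tau> c"
    then obtain g h where \<sigma>: "\<sigma> permutes {..<p}" and \<tau>: "\<tau> permutes {..<p}"
      and g: "g 0 = v" "inj_on g {..<2 * p}" "\<And>j. Suc j < 2 * p \<Longrightarrow> g (Suc j) = nb (g j) (c j)"
        "\<And>i. i < p \<Longrightarrow> ed (g i) (c (2 * p + i)) \<inter> g ` {..<2 * p} = g ` {i, p + \<sigma> i}"
      and h: "h 0 = v" "\<And>j. Suc j < 2 * p \<Longrightarrow> h (Suc j) = nb (h j) (c j)"
        "\<And>i. i < p \<Longrightarrow> ed (h i) (c (2 * p + i)) \<inter> h ` {..<2 * p} = h ` {i, p + \<tau> i}"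
      unfolding Q_def by metis
    \<comment> \<open>Both traces follow the same instructions from \<open>v\<close>, so they visit
      the same vertices in the same order.\<close>
    have gh: "g j = h j" if "j < 2 * p" for j
      using that by (induction j) (auto simp: g h)
    have "\<sigma> i = \<tau> i" if "i < p" for i
    proof -
      have im: "g ` {..<2 * p} = h ` {..<2 * p}" using gh by (intro image_cong) auto
      have lt: "\<sigma> i < p" "\<tau> i < p"
        using that permutes_in_image[OF \<sigma>, of i] permutes_in_image[OF \<tau>, of i] by auto
      \<comment> \<open>The common code selects the same edge, and the two sets of branch vertices
        agree, so the recorded intersections agree as well.\<close>
      have "g ` {i, p + \<sigma> i} = h ` {i, p + \<tau> i}"
        using g(4)[OF that] h(3)[OF that] gh[of i] that im by auto
      also have "\<dots> = g ` {i, p + \<tau> i}" using gh lt that by auto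
      finally have "{i, p + \<sigma> i} = {i, p + \<tau> i}"
        using g(2) lt that by (subst (asm) inj_on_image_eq_iff) auto
      with that show ?thesis by (auto simp: doubleton_eq_iff)
    qed
    moreover have "\<sigma> i = \<tau> i" if "\<not> i < p" for i
      using that \<sigma> \<tau> by (simp add: permutes_not_in)
    ultimately show "\<sigma> = \<tau>" by blast
  qed
  also have "card ?C = (d * k) ^ (3 * p)" by (simp add: card_PiE)
  finally show ?thesis .
qed

text \<open>Averaging: each vertex starts traces for at most \<open>(d * k) ^ (3 * p)\<close> of the
  \<open>fact p\<close> permutations. Double counting the pairs of a vertex and a permutation bounds
  the sum, and a permutation with the fewest starting vertices is at most the average.\<close>

lemma exists_perm_few_traces:
  fixes E :: "'a set set"
  assumes "finite E" "d > 0" "k > 0" "p > 0"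
    and card_E: "\<And>e. e \<in> E \<Longrightarrow> finite e \<and> card e = k"
    and deg: "\<And>v. card {e \<in> E. v \<in> e} \<le> d"
  shows "\<exists>\<sigma>. \<sigma> permutes {..<p} \<and>
    fact p * card {v \<in> \<Union>E. traced E p \<sigma> v} \<le> card (\<Union>E) * (d * k) ^ (3 * p)"
proof -
  let ?P = "{\<sigma>. \<sigma> permutes {..<p}}"
  have finP: "finite ?P" by (simp add: finite_permutations)
  have "id \<in> ?P" by (simp add: permutes_id)
  have cardP: "card ?P = fact p" by (rule card_permutations) auto
  have finV: "finite (\<Union>E)" using assms by blast
  let ?r = "\<lambda>\<sigma>. card {v \<in> \<Union>E. traced E p \<sigma> v}"
  obtain \<sigma> where \<sigma>: "\<sigma> \<in> ?P" "\<And>\<tau>. \<tau> \<in> ?P \<Longrightarrow> ?r \<sigma> \<le> ?r \<tau>"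
  proof -
    obtain m where m: "m \<in> ?r ` ?P" "\<not> (\<exists>x\<in>?r ` ?P. x < m)"
      using ex_min_if_finite[of "?r ` ?P"] finP \<open>id \<in> ?P\<close> by blast
    from m(1) obtain \<sigma> where \<sigma>: "\<sigma> \<in> ?P" "m = ?r \<sigma>" by (rule imageE)
    have "?r \<sigma> \<le> ?r \<tau>" if "\<tau> \<in> ?P" for \<tau>
      using m(2) that unfolding \<sigma>(2) by (meson image_eqI not_less)
    with \<sigma>(1) that show ?thesis by blast
  qed
  have "fact p * ?r \<sigma> \<le> (\<Sum>\<tau>\<in>?P. ?r \<tau>)"
    using sum_bounded_below[of ?P "?r \<sigma>" ?r] \<sigma>(2) cardP by auto
  also have "\<dots> = (\<Sum>v\<in>\<Union>E. card {\<tau> \<in> ?P. traced E p \<tau> v})"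
    using finP finV by (intro sum_multicount_gen) auto
  also have "\<dots> \<le> (\<Sum>v\<in>\<Union>E. (d * k) ^ (3 * p))"
    using card_traced_perms[OF assms(1-3) card_E deg] by (intro sum_mono) auto
  finally show ?thesis using \<sigma>(1) by auto
qed

section \<open>Degree sums and a factorial estimate\<close>

lemma sum_degrees:
  fixes E :: "'a set set"
  assumes "finite E" "\<And>e. e \<in> E \<Longrightarrow> finite e \<and> card e = k"
  shows "(\<Sum>v\<in>\<Union>E. card {e \<in> E. v \<in> e}) = k * card E"
proof -
  have "(\<Sum>v\<in>\<Union>E. card {e \<in> E. v \<in> e}) = (\<Sum>e\<in>E. card {v \<in> \<Union>E. v \<in> e})"
    using assms by (intro sum_multicount_gen) auto
  also have "\<dots> = (\<Sum>e\<in>E. k)"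
  proof (rule sum.cong)
    fix e assume "e \<in> E"
    then have "{v \<in> \<Union>E. v \<in> e} = e" by auto
    with \<open>e \<in> E\<close> show "card {v \<in> \<Union>E. v \<in> e} = k" using assms(2) by simp
  qed auto
  finally show ?thesis by simp
qed

text \<open>Markov's inequality for the degrees, whose sum is \<open>k * card E\<close>.\<close>

lemma card_high_degree:
  fixes E :: "'a set set"
  assumes "finite E" "\<And>e. e \<in> E \<Longrightarrow> finite e \<and> card e = k"
  shows "card {v \<in> \<Union>E. card {e \<in> E. v \<in> e} > d} * d \<le> k * card E"
proof -
  have finV: "finite (\<Union>E)" using assms by blast
  let ?S = "{v \<in> \<Union>E. card {e \<in> E. v \<in> e} > d}"
  have "card ?S * d = (\<Sum>v\<in>?S. d)" by simp
  also have "\<dots> \<le> (\<Sum>v\<in>?S. card {e \<in> E. v \<in> e})" by (intro sum_mono) auto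
  also have "\<dots> \<le> (\<Sum>v\<in>\<Union>E. card {e \<in> E. v \<in> e})"
    using finV by (intro sum_mono2) auto
  finally show ?thesis using sum_degrees[OF assms] by simp
qed

text \<open>A single term of the exponential series gives \<open>p ^ p / fact p \<le> exp p\<close>,
  and \<open>exp 1 \<le> 3\<close>.\<close>

lemma power_le_fact:
  assumes "3 * x \<le> p"
  shows "x ^ p \<le> fact p"
proof -
  have "real p ^ p / fact p \<le> exp (real p)"
    using sum_le_suminf[of "\<lambda>n. real p ^ n /\<^sub>R fact n" "{p}"] exp_converges[of "real p"]
    by (simp add: sums_iff divide_inverse mult.commute)
  also have "\<dots> = exp 1 ^ p" by (simp add: exp_of_nat_mult[of p 1, simplified])
  also have "\<dots> \<le> 3 ^ p" by (intro power_mono exp_le) auto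
  finally have le: "real p ^ p \<le> 3 ^ p * fact p" by (simp add: field_simps)
  have "(3 * real x) ^ p \<le> real p ^ p"
    using assms by (intro power_mono) linarith+
  from order.trans[OF this le] have "3 ^ p * real x ^ p \<le> 3 ^ p * fact p"
    by (simp add: power_mult_distrib)
  then have "real x ^ p \<le> fact p" by simp
  then have "real (x ^ p) \<le> real (fact p)" by simp
  then show ?thesis by (simp only: of_nat_le_iff)
qed

section \<open>The hypergraph of braids and stars\<close>

text \<open>These are the vertices before expansion: \<open>Inl (\<sigma>, j)\<close> is branch
  vertex \<open>j\<close> of the braid of \<open>\<sigma>\<close>, \<open>Inr (m, 0)\<close> the
  centre of star \<open>m\<close>, and \<open>Inr (m, i)\<close> with \<open>i > 0\<close> one of
  its \<open>k + 1\<close> leaves.\<close>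

definition braids_stars_verts :: "nat \<Rightarrow> nat \<Rightarrow> nat \<Rightarrow> ((nat \<Rightarrow> nat) \<times> nat + nat \<times> nat) set" where
  "braids_stars_verts k p M =
     Inl ` ({\<sigma>. \<sigma> permutes {..<p}} \<times> {..<2 * p}) \<union> Inr ` ({..<M} \<times> {..k + 1})"

definition braids_stars_edges :: "nat \<Rightarrow> nat \<Rightarrow> nat \<Rightarrow> ((nat \<Rightarrow> nat) \<times> nat + nat \<times> nat) set set" where
  "braids_stars_edges k p M =
     (\<Union>\<sigma>\<in>{\<sigma>. \<sigma> permutes {..<p}}. (`) (\<lambda>j. Inl (\<sigma>, j)) ` braid p \<sigma>) \<union>
     (\<lambda>(m, i). {Inr (m, 0), Inr (m, i)}) ` ({..<M} \<times> {1..k + 1})"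

definition braids_stars where
  "braids_stars k p M =
     expansion (k - 2) (braids_stars_verts k p M) (braids_stars_edges k p M)"

lemma finite_braids_stars_verts: "finite (braids_stars_verts k p M)"
  by (auto simp: braids_stars_verts_def finite_permutations)

lemma braid_edge:
  assumes "\<sigma> permutes {..<p}" "D \<in> braid p \<sigma>"
  shows "D \<subseteq> {..<2 * p}" "card D = 2"
  using assms(2) permutes_in_image[OF assms(1)] by (force simp: braid_def)+

lemma braids_stars_edge:
  assumes "e \<in> braids_stars_edges k p M"
  shows "e \<subseteq> braids_stars_verts k p M \<and> card e = 2"
proof -
  consider \<sigma> D where "\<sigma> permutes {..<p}" "D \<in> braid p \<sigma>" "e = (\<lambda>j. Inl (\<sigma>, j)) ` D"
    | m i where "m < M" "i \<in> {1..k + 1}" "e = {Inr (m, 0), Inr (m, i)}"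
    using assms by (auto simp: braids_stars_edges_def)
  then show ?thesis
  proof cases
    case 1
    then show ?thesis
      using braid_edge[OF 1(1,2)]
      by (auto simp: braids_stars_verts_def card_image inj_on_def)
  next
    case 2
    then show ?thesis by (auto simp: braids_stars_verts_def)
  qed
qed

lemma kgraph_braids_stars:
  assumes "k \<ge> 2"
  shows "kgraph k (braids_stars k p M)"
proof -
  have "kgraph (k - 2 + 2) (braids_stars k p M)"
    unfolding braids_stars_def
    by (intro kgraph_expansion finite_braids_stars_verts braids_stars_edge)
  with assms show ?thesis by (simp only: le_add_diff_inverse2)
qed

text \<open>After expansion a braid has at most \<open>2 * p + 3 * p * (k - 2)\<close> vertices, and
  a star has \<open>(k + 2) + (k + 1) * (k - 2)\<close>, which is exactly the square of
  \<open>k\<close>.\<close>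

lemma card_braids_stars_le:
  assumes "k \<ge> 2"
  shows "card (verts (braids_stars k p M)) \<le> fact p * (3 * p * k) + M * k\<^sup>2"
proof -
  let ?P = "{\<sigma>. \<sigma> permutes {..<p}}"
  have finP: "finite ?P" by (simp add: finite_permutations)
  have cardP: "card ?P = fact p" by (rule card_permutations) auto
  have "card (braids_stars_verts k p M) \<le> fact p * (2 * p) + M * (k + 2)"
    unfolding braids_stars_verts_def
    by (rule order.trans[OF card_Un_le]) (auto simp: card_image inj_on_def card_cartesian_product cardP)
  moreover have braid: "card (braid p \<sigma>) \<le> 3 * p" "finite (braid p \<sigma>)" for \<sigma>
  proof -
    have sub: "{j. Suc j < 2 * p} \<subseteq> {..<2 * p}" by auto
    have "card ((\<lambda>j. {j, Suc j}) ` {j. Suc j < 2 * p}) \<le> card {j. Suc j < 2 * p}"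
      by (intro card_image_le finite_subset[OF sub]) auto
    also have "\<dots> \<le> 2 * p" using card_mono[OF _ sub] by simp
    finally have "card ((\<lambda>j. {j, Suc j}) ` {j. Suc j < 2 * p}) \<le> 2 * p" .
    moreover have "card ((\<lambda>i. {i, p + \<sigma> i}) ` {..<p}) \<le> p"
      using card_image_le[of "{..<p}"] by force
    ultimately show "card (braid p \<sigma>) \<le> 3 * p"
      unfolding braid_def by (intro order.trans[OF card_Un_le]) linarith
    show "finite (braid p \<sigma>)"
      unfolding braid_def using finite_subset[OF sub] by auto
  qed
  have "card (braids_stars_edges k p M) \<le> fact p * (3 * p) + M * (k + 1)"
  proof -
    have "card (\<Union>\<sigma>\<in>?P. (`) (\<lambda>j. Inl (\<sigma>, j) :: _ + nat \<times> nat) ` braid p \<sigma>)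
        \<le> (\<Sum>\<sigma>\<in>?P. card ((`) (\<lambda>j. Inl (\<sigma>, j) :: _ + nat \<times> nat) ` braid p \<sigma>))"
      using finP by (rule card_UN_le)
    also have "\<dots> \<le> (\<Sum>\<sigma>\<in>?P. 3 * p)"
      by (intro sum_mono order.trans[OF card_image_le] braid)
    also have "\<dots> = fact p * (3 * p)" using cardP by simp
    finally have A: "card (\<Union>\<sigma>\<in>?P. (`) (\<lambda>j. Inl (\<sigma>, j) :: _ + nat \<times> nat) ` braid p \<sigma>) \<le> fact p * (3 * p)" .
    have "card ((\<lambda>(m, i). {Inr (m, 0), Inr (m, i) :: (nat \<Rightarrow> nat) \<times> nat + nat \<times> nat}) ` ({..<M} \<times> {1..k + 1}))
        \<le> M * (k + 1)"
      by (rule order.trans[OF card_image_le]) (auto simp: card_cartesian_product)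
    with A show ?thesis
      unfolding braids_stars_edges_def by (intro order.trans[OF card_Un_le] add_mono)
  qed
  moreover have "finite (braids_stars_edges k p M)"
    using finite_braids_stars_verts
    by (intro finite_subset[of "braids_stars_edges k p M" "Pow (braids_stars_verts k p M)"])
       (auto dest: braids_stars_edge)
  ultimately have "card (verts (braids_stars k p M))
      \<le> (fact p * (2 * p) + M * (k + 2)) + (fact p * (3 * p) + M * (k + 1)) * (k - 2)"
    unfolding braids_stars_def
    by (simp add: card_verts_expansion finite_braids_stars_verts add_mono)
  also have "\<dots> \<le> fact p * (3 * p * k) + M * k\<^sup>2"
  proof -
    \<comment> \<open>Writing \<open>k\<close> as \<open>r + 2\<close> removes the truncated
      subtraction.\<close>
    obtain r where r: "k = r + 2" using assms by (metis add.commute le_Suc_ex)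
    show ?thesis by (simp add: r algebra_simps power2_eq_square)
  qed
  finally show ?thesis .
qed

text \<open>The candidates are the two path edges at \<open>j\<close> and the matching edge read
  from its lower or its upper end. Some candidates are not edges, such as the first one for
  \<open>j = 0\<close>, but an upper bound tolerates that.\<close>

lemma card_braids_stars_edges_at_Inl:
  assumes "\<sigma> permutes {..<p}"
  shows "card {e \<in> braids_stars_edges k p M. Inl (\<sigma>, j) \<in> e} \<le> 4"
proof -
  let ?I = "(`) (\<lambda>j. Inl (\<sigma>, j) :: _ + nat \<times> nat)"
  let ?F = "{?I {j - 1, j}, ?I {j, Suc j}, ?I {j, p + \<sigma> j}, ?I {inv \<sigma> (j - p), j}}"
  have "{e \<in> braids_stars_edges k p M. Inl (\<sigma>, j) \<in> e} \<subseteq> ?F"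
  proof
    fix e assume "e \<in> {e \<in> braids_stars_edges k p M. Inl (\<sigma>, j) \<in> e}"
    then obtain D where D: "D \<in> braid p \<sigma>" "j \<in> D" "e = ?I D"
      by (auto simp: braids_stars_edges_def)
    consider i where "D = {i, Suc i}" | i where "D = {i, p + \<sigma> i}"
      using D(1) unfolding braid_def by blast
    then have "D = {j - 1, j} \<or> D = {j, Suc j} \<or> D = {j, p + \<sigma> j} \<or> D = {inv \<sigma> (j - p), j}"
    proof cases
      case 1
      with D(2) have "i = j \<or> j = Suc i" by auto
      with 1 show ?thesis by (elim disjE) simp_all
    next
      case 2
      with D(2) have "i = j \<or> j = p + \<sigma> i" by auto
      with 2 show ?thesis by (elim disjE) (simp_all add: permutes_inverses[OF assms])
    qed
    with D(3) show "e \<in> ?F" by blast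
  qed
  then have "card {e \<in> braids_stars_edges k p M. Inl (\<sigma>, j) \<in> e} \<le> card ?F"
    by (intro card_mono) auto
  also have "\<dots> \<le> 4" by (simp add: card_insert_le_m1)
  finally show ?thesis .
qed

lemma card_braids_stars_edges_at_centre:
  assumes "m < M"
  shows "card {e \<in> braids_stars_edges k p M. Inr (m, 0) \<in> e} = k + 1"
proof -
  have "{e \<in> braids_stars_edges k p M. Inr (m, 0) \<in> e} =
      (\<lambda>i. {Inr (m, 0), Inr (m, i)}) ` {1..k + 1}"
    using assms by (force simp: braids_stars_edges_def)
  moreover have "inj_on (\<lambda>i. {Inr (m, 0), Inr (m, i)} :: ((nat \<Rightarrow> nat) \<times> nat + nat \<times> nat) set) {1..k + 1}"
    by (auto simp: inj_on_def doubleton_eq_iff)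
  ultimately show ?thesis by (simp add: card_image)
qed

lemma card_braids_stars_edges_at_leaf:
  assumes "i > 0"
  shows "card {e \<in> braids_stars_edges k p M. Inr (m, i) \<in> e} \<le> 1"
proof -
  have "{e \<in> braids_stars_edges k p M. Inr (m, i) \<in> e} \<subseteq> {{Inr (m, 0), Inr (m, i)}}"
    using assms by (auto simp: braids_stars_edges_def)
  from card_mono[OF _ this] show ?thesis by simp
qed

text \<open>The star centres attain \<open>k + 1\<close>. Branch vertices of braids have degree at
  most 4, which is at most \<open>k + 1\<close> because \<open>k \<ge> 3\<close>.\<close>

lemma max_degree_braids_stars:
  assumes "k \<ge> 3" "M > 0"
  shows "max_degree (braids_stars k p M) = k + 1"
  unfolding max_degree_def
proof (rule Max_eqI)
  let ?G = "braids_stars k p M"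
  have finG: "finite (verts ?G)"
    using kgraph_braids_stars[of k p M] assms by (simp add: kgraph_def)
  then show "finite (insert 0 (degree ?G ` verts ?G))" by simp
  have "degree ?G x \<le> k + 1" if "x \<in> verts ?G" for x
  proof (cases x)
    case (Inl v)
    with that have v: "v \<in> braids_stars_verts k p M"
      by (auto simp: braids_stars_def expansion_def)
    show ?thesis
    proof (cases v)
      case [simp]: (Inl w)
      obtain \<sigma> j where [simp]: "w = (\<sigma>, j)" by fastforce
      have "\<sigma> permutes {..<p}" using v by (auto simp: braids_stars_verts_def)
      from card_braids_stars_edges_at_Inl[OF this, of k M j] assms show ?thesis
        by (simp add: \<open>x = Inl v\<close> braids_stars_def degree_expansion_Inl)
    next
      case [simp]: (Inr w)
      obtain m i where [simp]: "w = (m, i)" by fastforce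
      have "m < M" using v by (auto simp: braids_stars_verts_def)
      then show ?thesis
        using card_braids_stars_edges_at_centre[of m M k p] card_braids_stars_edges_at_leaf[of i k p M m]
        by (cases "i = 0") (auto simp: \<open>x = Inl v\<close> braids_stars_def degree_expansion_Inl)
    qed
  next
    case (Inr bl)
    then show ?thesis
      using degree_expansion_Inr[of "k - 2" "braids_stars_verts k p M" "braids_stars_edges k p M" bl]
      by (simp add: braids_stars_def)
  qed
  then show "y \<le> k + 1" if "y \<in> insert 0 (degree ?G ` verts ?G)" for y
    using that by auto
  let ?c = "Inl (Inr (0, 0))"
  have "?c \<in> verts ?G"
    using assms by (auto simp: braids_stars_def expansion_def braids_stars_verts_def)
  moreover have "degree ?G ?c = k + 1"
    using card_braids_stars_edges_at_centre[of 0 M k p] assms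
    by (simp add: braids_stars_def degree_expansion_Inl)
  ultimately show "k + 1 \<in> insert 0 (degree ?G ` verts ?G)"
    by (metis image_eqI insertI2)
qed

section \<open>Copies inside a host and the bound on its edges\<close>

lemma edges_braids_stars_braid:
  assumes "\<sigma> permutes {..<p}" "D \<in> braid p \<sigma>"
  shows "expand_edge (k - 2) ((\<lambda>j. Inl (\<sigma>, j)) ` D) \<in> edges (braids_stars k p M)"
  using assms by (auto simp: braids_stars_def expansion_def braids_stars_edges_def)

lemma edges_braids_stars_star:
  assumes "m < M"
  shows "expand_edge (k - 2) {Inr (m, 0), Inr (m, 1)} \<in> edges (braids_stars k p M)"
  using assms by (force simp: braids_stars_def expansion_def braids_stars_edges_def)

lemma kgraph_edge_subset: "kgraph k G \<Longrightarrow> e \<in> edges G \<Longrightarrow> e \<subseteq> verts G"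
  by (simp add: kgraph_def)

text \<open>One edge from each star gives \<open>M\<close> pairwise disjoint edges; their images
  stay disjoint, and \<open>X\<close> needs a separate vertex for each.\<close>

lemma cover_of_braids_stars_copy:
  assumes "k \<ge> 2" "finite X" "contains_copy H (braids_stars k p M)"
    and cover: "\<And>e. e \<in> edges H \<Longrightarrow> e \<inter> X \<noteq> {}"
  shows "M \<le> card X"
proof -
  let ?G = "braids_stars k p M"
  obtain f where f: "inj_on f (verts ?G)" "\<And>e. e \<in> edges ?G \<Longrightarrow> f ` e \<in> edges H"
    using assms(3) unfolding contains_copy_def by blast
  define st where "st m = expand_edge (k - 2)
    {Inr (m, 0), Inr (m, 1) :: (nat \<Rightarrow> nat) \<times> nat + nat \<times> nat}" for m
  have st: "st m \<in> edges ?G" if "m < M" for m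
    using edges_braids_stars_star[OF that] by (simp only: st_def)
  have st_sub: "st m \<subseteq> verts ?G" if "m < M" for m
    by (rule kgraph_edge_subset[OF kgraph_braids_stars[OF assms(1)] st[OF that]])
  have "\<exists>x. x \<in> f ` st m \<inter> X" if "m < M" for m
    using cover[OF f(2)[OF st[OF that]]] by blast
  then obtain h where h: "\<And>m. m < M \<Longrightarrow> h m \<in> f ` st m \<inter> X" by metis
  have disj: "st m \<inter> st m' = {}" if "m \<noteq> m'" for m m'
  proof (rule equals0I)
    fix x assume x: "x \<in> st m \<inter> st m'"
    show False
    proof (cases x)
      case (Inl a)
      with x that show False by (auto simp: st_def)
    next
      \<comment> \<open>A shared private vertex would carry both star edges as its tag, forcing
        \<open>m = m'\<close>.\<close>
      case (Inr bl)
      then obtain b l where bl: "x = Inr (b, l)" by (cases bl) auto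
      from x[THEN IntD1] have "b = {Inr (m, 0), Inr (m, 1)}"
        unfolding bl st_def Inr_mem_expand_edge by (rule conjunct1)
      moreover from x[THEN IntD2] have "b = {Inr (m', 0), Inr (m', 1)}"
        unfolding bl st_def Inr_mem_expand_edge by (rule conjunct1)
      ultimately have "{Inr (m, 0), Inr (m, 1) :: (nat \<Rightarrow> nat) \<times> nat + nat \<times> nat} = {Inr (m', 0), Inr (m', 1)}"
        by (rule trans[OF sym])
      with that show False by (simp add: doubleton_eq_iff)
    qed
  qed
  have "inj_on h {..<M}"
  proof (rule inj_onI, rule ccontr)
    fix m m' assume *: "m \<in> {..<M}" "m' \<in> {..<M}" "h m = h m'" "m \<noteq> m'"
    have "f ` st m \<inter> f ` st m' = f ` (st m \<inter> st m')"
      using * by (intro inj_on_image_Int[OF f(1), symmetric] st_sub) simp_all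
    with disj[OF *(4)] h[of m] h[of m'] * show False by auto
  qed
  with h assms(2) have "card {..<M} \<le> card X" by (intro card_inj_on_le[of h]) auto
  then show ?thesis by simp
qed

text \<open>The embedding restricted to the branch vertices is a trace: an expanded edge meets them
  only in its two original vertices, and injectivity preserves this intersection.\<close>

lemma traced_of_braids_stars_copy:
  assumes "k \<ge> 2" "p > 0" "\<sigma> permutes {..<p}" "contains_copy H (braids_stars k p M)"
  shows "\<exists>v \<in> \<Union>(edges H). traced (edges H) p \<sigma> v"
proof -
  let ?G = "braids_stars k p M"
  obtain f where f: "inj_on f (verts ?G)" "\<And>e. e \<in> edges ?G \<Longrightarrow> f ` e \<in> edges H"
    using assms(4) unfolding contains_copy_def by blast
  let ?x = "\<lambda>j. Inl (Inl (\<sigma>, j))"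
  let ?e = "\<lambda>D. expand_edge (k - 2) ((\<lambda>j. Inl (\<sigma>, j)) ` D)"
  define g where "g j = f (?x j)" for j
  have x: "?x ` {..<2 * p} \<subseteq> verts ?G"
    using assms(3) by (auto simp: braids_stars_def expansion_def braids_stars_verts_def)
  have "inj_on (f \<circ> ?x) {..<2 * p}"
    using f(1) x by (intro comp_inj_on) (auto simp: inj_on_def)
  then have inj: "inj_on g {..<2 * p}" by (simp add: g_def[abs_def] comp_def)
  have tr: "f ` ?e D \<in> edges H \<and> f ` ?e D \<inter> g ` {..<2 * p} = g ` D"
    if "D \<in> braid p \<sigma>" for D
  proof -
    have e: "?e D \<in> edges ?G" using edges_braids_stars_braid assms(3) that by blast
    have "g ` A = f ` ?x ` A" for A by (simp add: g_def[abs_def] image_image)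
    then have "f ` ?e D \<inter> g ` {..<2 * p} = f ` (?e D \<inter> ?x ` {..<2 * p})"
      using inj_on_image_Int[OF f(1) kgraph_edge_subset[OF kgraph_braids_stars[OF assms(1)] e] x]
      by simp
    also have "?e D \<inter> ?x ` {..<2 * p} = ?x ` D"
      using braid_edge[OF assms(3) that] by auto
    finally show ?thesis using f(2)[OF e] by (simp add: g_def[abs_def] image_image)
  qed
  have "\<exists>e\<in>edges H. e \<inter> g ` {..<2 * p} = g ` D" if "D \<in> braid p \<sigma>" for D
    using tr[OF that] by (intro bexI[of _ "f ` ?e D"]) simp_all
  with inj have "traced (edges H) p \<sigma> (g 0)"
    unfolding traced_def by (intro exI[of _ g] conjI refl ballI)
  moreover have "g 0 \<in> \<Union>(edges H)"
  proof -
    \<comment> \<open>The matching edge at 0 exists because \<open>p > 0\<close>, and it places the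
      start of the trace in a host edge.\<close>
    have D: "{0, p + \<sigma> 0} \<in> braid p \<sigma>"
      using assms(2) by (auto simp: braid_def)
    have "g 0 \<in> g ` {0, p + \<sigma> 0}" by simp
    then have "g 0 \<in> f ` ?e {0, p + \<sigma> 0}"
      unfolding tr[OF D, THEN conjunct2, symmetric] by (rule IntD1)
    then show ?thesis by (rule UnionI[OF tr[OF D, THEN conjunct1]])
  qed
  ultimately show ?thesis by (rule bexI)
qed

lemma traced_mono: "E \<subseteq> E' \<Longrightarrow> traced E p \<sigma> v \<Longrightarrow> traced E' p \<sigma> v"
proof -
  assume sub: "E \<subseteq> E'" and "traced E p \<sigma> v"
  then obtain g where g: "g 0 = v \<and> inj_on g {..<2 * p} \<and>
      (\<forall>D\<in>braid p \<sigma>. \<exists>e\<in>E. e \<inter> g ` {..<2 * p} = g ` D)"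
    unfolding traced_def by (elim exE)
  have "\<exists>e\<in>E'. e \<inter> g ` {..<2 * p} = g ` D" if "D \<in> braid p \<sigma>" for D
    using bspec[OF g[THEN conjunct2, THEN conjunct2] that]
    by (rule bexE) (rule bexI[OF _ subsetD[OF sub]])
  with g show ?thesis
    unfolding traced_def by (intro exI[of _ g]) simp
qed

text \<open>The cover \<open>S \<union> R\<close> must have at least \<open>M\<close> vertices,
  while \<open>card S * d\<close> and \<open>card R * d\<close> are each at most
  \<open>k * card E\<close>. For \<open>R\<close>, the exponent \<open>4 * p\<close> in
  \<open>large\<close> exceeds the \<open>3 * p\<close> of the trace count, and the spare factor
  \<open>(d * k) ^ p\<close> pays for \<open>d\<close>.\<close>

lemma arrows_braids_stars_lower:
  assumes "kgraph k H" "arrows H (braids_stars k p M)" "k \<ge> 2" "p > 0" "d > 0"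
    and large: "(d * k) ^ (4 * p) \<le> fact p"
  shows "M * d \<le> 2 * k * card (edges H)"
proof -
  define E where "E = edges H"
  have finE: "finite E" unfolding E_def by (rule kgraph_finite_edges[OF assms(1)])
  have cardE: "finite e \<and> card e = k" if "e \<in> E" for e
    using assms(1) that unfolding E_def kgraph_def by (auto intro: finite_subset)
  define S where "S = {v \<in> \<Union>E. card {e \<in> E. v \<in> e} > d}"
  define E' where "E' = {e \<in> E. e \<inter> S = {}}"
  have E': "E' \<subseteq> E" "finite E'" using finE by (auto simp: E'_def)
  have deg: "card {e \<in> E'. v \<in> e} \<le> d" for v
  proof (cases "v \<in> \<Union>E - S")
    case True
    have "card {e \<in> E'. v \<in> e} \<le> card {e \<in> E. v \<in> e}"
      using finE E' by (intro card_mono) auto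
    with True show ?thesis by (auto simp: S_def)
  next
    case False
    then have "{e \<in> E'. v \<in> e} = {}" by (auto simp: E'_def)
    then show ?thesis by (simp only: card.empty)
  qed
  obtain \<sigma> where \<sigma>: "\<sigma> permutes {..<p}"
    and R: "fact p * card {v \<in> \<Union>E'. traced E' p \<sigma> v} \<le> card (\<Union>E') * (d * k) ^ (3 * p)"
    using exists_perm_few_traces[of E' d k p] assms E' cardE deg by auto
  define R where "R = {v \<in> \<Union>E'. traced E' p \<sigma> v}"
  have finV: "finite (\<Union>E)" using finE cardE by blast
  have fin: "finite (S \<union> R)"
    using finV E' by (auto simp: S_def R_def intro: finite_subset[of _ "\<Union>E"])
  obtain b where copy: "contains_copy (verts H, {e \<in> E. (e \<inter> (S \<union> R) \<noteq> {}) = b}) (braids_stars k p M)"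
    using assms(2)[unfolded arrows_def, THEN spec, of "\<lambda>e. e \<inter> (S \<union> R) \<noteq> {}"]
    unfolding E_def by (elim exE)
  \<comment> \<open>Otherwise all edges of the copy avoid \<open>S \<union> R\<close> and hence lie
    in \<open>E'\<close>; the trace of \<open>\<sigma>\<close> that they contain would start in
    \<open>R\<close>, yet inside one of these edges.\<close>
  have b: b
  proof (rule ccontr)
    assume "\<not> b"
    define F where "F = {e \<in> E. e \<inter> (S \<union> R) = {}}"
    have "contains_copy (verts H, F) (braids_stars k p M)"
      using copy \<open>\<not> b\<close> by (simp add: F_def)
    from traced_of_braids_stars_copy[OF assms(3,4) \<sigma> this]
    obtain v where v: "v \<in> \<Union>F" "traced F p \<sigma> v" by auto
    have "F \<subseteq> E'" by (auto simp: F_def E'_def)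
    then have "v \<in> R" using v traced_mono[of F E'] by (auto simp: R_def)
    with v(1) show False by (auto simp: F_def)
  qed
  have "M \<le> card (S \<union> R)"
    using copy b by (intro cover_of_braids_stars_copy[OF assms(3) fin]) auto
  also have "\<dots> \<le> card S + card R" by (rule card_Un_le)
  finally have "M * d \<le> card S * d + card R * d"
    by (metis add_mult_distrib mult_le_mono1)
  moreover have "card S * d \<le> k * card E"
    unfolding S_def by (rule card_high_degree[OF finE cardE])
  moreover have "card R * d \<le> k * card E"
  proof -
    have "card (\<Union>E') \<le> (\<Sum>e\<in>E'. card e)" by (rule card_Union_le_sum_card)
    also have "\<dots> = (\<Sum>e\<in>E'. k)" using cardE E'(1) by (intro sum.cong) blast+
    also have "\<dots> = card E' * k" by simp
    also have "\<dots> \<le> k * card E" using card_mono[OF finE E'(1)] by simp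
    finally have V: "card (\<Union>E') \<le> k * card E" .
    let ?q = "(d * k) ^ (3 * p)"
    have "?q > 0" using assms by simp
    have "d \<le> (d * k) ^ p"
    proof -
      have "d \<le> d * k" using assms by simp
      also have "\<dots> \<le> (d * k) ^ p" using assms by (intro self_le_power) auto
      finally show ?thesis .
    qed
    then have "?q * (card R * d) \<le> ?q * (card R * (d * k) ^ p)"
      by (intro mult_le_mono) auto
    also have "\<dots> = (d * k) ^ (4 * p) * card R"
      by (simp add: power_add[symmetric] mult_ac)
    also have "\<dots> \<le> fact p * card R" using large by simp
    also have "\<dots> \<le> ?q * card (\<Union>E')" using R by (simp add: R_def mult.commute)
    also have "\<dots> \<le> ?q * (k * card E)" using V by simp
    finally show ?thesis using \<open>?q > 0\<close> by (simp only: mult_le_cancel1)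
  qed
  ultimately show ?thesis unfolding E_def[symmetric] by linarith
qed

section \<open>Choice of parameters\<close>

text \<open>With \<open>s = sqrt (ln x)\<close>, the first left side has order
  \<open>ln x powr (1/4)\<close>, below \<open>s\<close>. In the second,
  \<open>s powr s = exp (s * ln s)\<close> grows more slowly than any positive power of
  \<open>x\<close>.\<close>

lemma eventually_growth:
  fixes k :: real
  assumes "k > 0"
  shows "\<forall>\<^sub>F x::real in at_top. 3 * (k * (8 * k^3 * ln x powr (1/16) + 1))^4 \<le> sqrt (ln x) - 1"
    and "\<forall>\<^sub>F x::real in at_top. sqrt (ln x) powr sqrt (ln x) * (3 * sqrt (ln x) * k) \<le> x / 2"
    and "\<forall>\<^sub>F x::real in at_top. ln x \<ge> 1"
  using assms by real_asymp+

lemma eventually_parameters: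
  fixes k :: nat
  assumes "k > 0"
  shows "\<exists>N. \<forall>n\<ge>N. \<exists>p d M :: nat. p > 0 \<and> d > 0 \<and> M > 0 \<and>
    (d * k) ^ (4 * p) \<le> fact p \<and> fact p * (3 * p * k) + M * k\<^sup>2 \<le> n \<and>
    2 * real k * (real n * ln (real n) powr (1/16)) \<le> real (M * d)"
proof -
  have "\<forall>\<^sub>F x::real in at_top.
      3 * (real k * (8 * real k^3 * ln x powr (1/16) + 1))^4 \<le> sqrt (ln x) - 1 \<and>
      sqrt (ln x) powr sqrt (ln x) * (3 * sqrt (ln x) * real k) \<le> x / 2 \<and>
      ln x \<ge> 1 \<and> x \<ge> 4 * (real k)\<^sup>2"
    using assms by (intro eventually_conj eventually_growth[of "real k"] eventually_ge_at_top) auto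
  then obtain x0 :: real where x0: "\<And>x. x \<ge> x0 \<Longrightarrow>
      3 * (real k * (8 * real k^3 * ln x powr (1/16) + 1))^4 \<le> sqrt (ln x) - 1 \<and>
      sqrt (ln x) powr sqrt (ln x) * (3 * sqrt (ln x) * real k) \<le> x / 2 \<and>
      ln x \<ge> 1 \<and> x \<ge> 4 * (real k)\<^sup>2"
    unfolding eventually_at_top_linorder by blast
  show ?thesis
  proof (intro exI allI impI)
    fix n :: nat assume "n \<ge> nat \<lceil>x0\<rceil>"
    then have "real n \<ge> x0" by linarith
    note n = x0[OF this]
    define s where "s = sqrt (ln (real n))"
    define q where "q = ln (real n) powr (1/16)"
    define p where "p = nat \<lfloor>s\<rfloor>"
    \<comment> \<open>Since \<open>M\<close> will be at least \<open>n\<close> divided by four times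
      the square of \<open>k\<close>, the factor \<open>8 * real k ^ 3\<close> makes
      \<open>M * d\<close> at least \<open>2 * k * n * q\<close>.\<close>
    define d where "d = nat \<lceil>8 * real k ^ 3 * q\<rceil>"
    \<comment> \<open>Half of the vertex budget goes to the stars; the other half is left for the
      braids.\<close>
    define M where "M = n div (2 * k\<^sup>2)"
    have s1: "s \<ge> 1" using n by (simp add: s_def)
    have q0: "q > 0" using n by (simp add: q_def)
    have p: "p > 0" "real p \<le> s" "s - 1 \<le> real p" using s1 unfolding p_def by linarith+
    have "8 * real k ^ 3 * q > 0" using q0 assms by simp
    then have d: "d > 0" "8 * real k ^ 3 * q \<le> d" "d \<le> 8 * real k ^ 3 * q + 1"
      unfolding d_def by linarith+
    have nk: "real n \<ge> 4 * (real k)\<^sup>2" using n by simp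
    then have nk': "n \<ge> 4 * k\<^sup>2" by (metis of_nat_le_iff of_nat_mult of_nat_numeral of_nat_power)
    then have M: "M > 0" using assms by (simp add: M_def div_greater_zero_iff)
    \<comment> \<open>This is the hypothesis of \<open>power_le_fact\<close> for the base
      \<open>(d * k) ^ 4\<close>.\<close>
    have "(d * k) ^ 4 * 3 \<le> p"
    proof -
      have "real d * k \<le> k * (8 * real k ^ 3 * q + 1)" using mult_left_mono[OF d(3), of "real k"] by (simp add: mult_ac)
      then have "3 * (real d * k) ^ 4 \<le> 3 * (k * (8 * real k ^ 3 * q + 1)) ^ 4"
        by (intro mult_left_mono power_mono) auto
      also have "\<dots> \<le> s - 1" using n unfolding q_def s_def by (elim conjE)
      also have "\<dots> \<le> real p" by (rule p(3))
      finally have "real ((d * k) ^ 4 * 3) \<le> real p" by simp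
      then show ?thesis by (simp only: of_nat_le_iff)
    qed
    then have 1: "(d * k) ^ (4 * p) \<le> fact p"
      unfolding power_mult by (intro power_le_fact) (simp only: mult.commute)
    have "real (fact p * (3 * p * k)) \<le> n / 2"
    proof -
      have "real (fact p) \<le> real p ^ p" using fact_le_power[of p, where 'a = real] by simp
      also have "\<dots> \<le> s ^ p" using p by (intro power_mono) auto
      also have "\<dots> = s powr p" using s1 by (simp add: powr_realpow)
      also have "\<dots> \<le> s powr s" using s1 p by (intro powr_mono) auto
      finally have "real (fact p) \<le> s powr s" .
      then have "real (fact p) * (3 * real p * k) \<le> s powr s * (3 * s * k)"
        using p s1 by (intro mult_mono) auto
      also have "\<dots> \<le> n / 2" using n by (simp add: s_def)
      finally show ?thesis by simp
    qed
    then have "2 * (fact p * (3 * p * k)) \<le> n" by linarith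
    moreover have "2 * (M * k\<^sup>2) \<le> n"
      using div_times_less_eq_dividend[of n "2 * k\<^sup>2"] by (simp add: M_def mult_ac)
    ultimately have 2: "fact p * (3 * p * k) + M * k\<^sup>2 \<le> n" by linarith
    have "n < (M + 1) * (2 * k\<^sup>2)"
      using dividend_less_div_times[of "2 * k\<^sup>2" n] assms by (simp add: M_def add.commute)
    then have "real n < real ((M + 1) * (2 * k\<^sup>2))" by (simp only: of_nat_less_iff)
    \<comment> \<open>The rounding in \<open>M\<close> loses at most half of \<open>n\<close>, by
      \<open>nk\<close>.\<close>
    then have "real n \<le> M * (4 * (real k)\<^sup>2)" using nk by (simp add: algebra_simps)
    then have "real n * (2 * k * q) \<le> M * (4 * (real k)\<^sup>2) * (2 * k * q)"
      using q0 by (intro mult_right_mono) auto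
    also have "\<dots> = M * (8 * real k ^ 3 * q)" by (simp add: power2_eq_square power3_eq_cube)
    also have "\<dots> \<le> M * real d" using d(2) by (intro mult_left_mono) auto
    finally have 3: "2 * real k * (real n * q) \<le> real (M * d)" by (simp add: mult_ac)
    show "p > 0 \<and> d > 0 \<and> M > 0 \<and>
      (d * k) ^ (4 * p) \<le> fact p \<and> fact p * (3 * p * k) + M * k\<^sup>2 \<le> n \<and>
      2 * real k * (real n * ln (real n) powr (1/16)) \<le> real (M * d)"
      using p(1) d(1) M 1 2 3 by (simp add: q_def)
  qed
qed

section \<open>The polylogarithmic lower bound, with \<open>c = 1/16\<close> and
  \<open>C = 1\<close>\<close>

theorem theorem4:
  fixes k :: nat
  assumes "k \<ge> 3"
  shows "\<exists>c C :: real. c > 0 \<and> C > 0 \<and>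
    (\<exists>N :: nat. \<forall>n \<ge> N. \<exists>G :: nat hypergraph.
        kgraph k G \<and> card (verts G) \<le> n \<and> max_degree G = k + 1 \<and>
        real (size_ramsey k G) \<ge> C * real n * ln (real n) powr c)"
proof -
  have k: "k > 0" "k \<ge> 2" using assms by auto
  obtain N where N: "\<And>n. n \<ge> N \<Longrightarrow> \<exists>p d M :: nat. p > 0 \<and> d > 0 \<and> M > 0 \<and>
    (d * k) ^ (4 * p) \<le> fact p \<and> fact p * (3 * p * k) + M * k\<^sup>2 \<le> n \<and>
    2 * real k * (real n * ln (real n) powr (1/16)) \<le> real (M * d)"
    using eventually_parameters[OF k(1)] by blast
  have "\<exists>G :: nat hypergraph. kgraph k G \<and> card (verts G) \<le> n \<and> max_degree G = k + 1 \<and>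
      real (size_ramsey k G) \<ge> 1 * real n * ln (real n) powr (1/16)" if n: "n \<ge> N" for n
  proof -
    obtain p d M :: nat where pdM: "p > 0" "d > 0" "M > 0" "(d * k) ^ (4 * p) \<le> fact p"
      and size: "fact p * (3 * p * k) + M * k\<^sup>2 \<le> n"
      and large: "2 * real k * (real n * ln (real n) powr (1/16)) \<le> real (M * d)"
      using N[OF n] by blast
    let ?T = "braids_stars k p M"
    have T: "kgraph k ?T" by (rule kgraph_braids_stars[OF k(2)])
    then have "finite (verts ?T)" by (simp add: kgraph_def)
    then obtain g :: "_ \<Rightarrow> nat" where g: "inj_on g (verts ?T)"
      using finite_imp_inj_to_nat_seg by metis
    let ?G = "rename g ?T"
    have G: "kgraph k ?G" by (rule kgraph_rename[OF T g])
    have "card (verts ?G) \<le> n"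
      using card_braids_stars_le[OF k(2), of p M] size g by (simp add: rename_def card_image)
    moreover have "max_degree ?G = k + 1"
      using max_degree_rename[OF T g] max_degree_braids_stars[OF assms pdM(3)] by simp
    moreover obtain H :: "nat hypergraph" where H: "kgraph k H" "arrows H ?G"
      "card (edges H) = size_ramsey k ?G"
      using size_ramsey_attained[OF G] by blast
    \<comment> \<open>An optimal host for the renamed hypergraph is also a host for
      \<open>?T\<close>, to which the edge bound applies.\<close>
    have "M * d \<le> 2 * k * size_ramsey k ?G"
      using arrows_braids_stars_lower[OF H(1) arrows_rename[OF T g H(2)] k(2) pdM(1,2,4)] H(3)
      by simp
    then have "real (M * d) \<le> real (2 * k * size_ramsey k ?G)" by (simp only: of_nat_le_iff)
    with large have "2 * real k * (real n * ln (real n) powr (1/16)) \<le> 2 * real k * size_ramsey k ?G"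
      by simp
    then have "real n * ln (real n) powr (1/16) \<le> size_ramsey k ?G"
      using k(1) by (subst (asm) mult_le_cancel_left_pos) auto
    ultimately show ?thesis using G by (intro exI[of _ ?G]) simp
  qed
  then show ?thesis
    by (intro exI[of _ "1/16"] exI[of _ 1]) auto
qed

end
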